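(* Let $\ell$ be a linkage function whose clustering sequence on every finite metric space respects the diameter bound at every step. Then for any finite metric space $(X,d)$ and any merge of $\ell$'s clustering, where blocks $A,B$ merge at scale $r=\ell(A,B)$, $$\ell(A,B)\ge\mathrm{diam}(A\cup B).$$ Complete linkage achieves this bound with equality at every merge: when $A,B$ are blocks formed during complete linkage's clustering, $$\ell_{\mathrm{complete}}(A,B)=\mathrm{diam}(A\cup B).$$ In this sense, complete linkage merges as early as the diameter bound permits.
   Context: Given a finite metric space $(X,d)$, a linkage function $\ell$ assigns to each pair of disjoint nonempty subsets $A,B\subseteq X$ a nonnegative real number depending only on the pairwise distances, $\ell(A,B)=f(\{d(x,y):x\in A,\,y\in B\})$. Complete linkage is the case $f=\max$, that is, $\ell_{\mathrm{complete}}(A,B)=\max_{x\in A,\,y\in B}d(x,y)$. The diameter of a subset $C\subseteq X$ is $\mathrm{diam}(C)=\max_{x,y\in C}d(x,y)$. Given a linkage $\ell$, hierarchical clustering on $(X,d)$ produces a sequence of partitions $P_0\prec P_1\prec\cdots\prec P_N$ of $X$, where $P_0=\{\{x\}:x\in X\}$ is the discrete partition, $P_N=\{X\}$, and each $P_{k+1}$ is obtained from $P_k$ by merging the two blocks $A,B\in P_k$ that correspond to the minimum value of $\ell$ over $P_k$ (when several pairs achieve the minimum, a choice is made). The merge scale is $r_{k+1}:=\ell(A,B)$, with $r_0:=0$. The sequence determines a family of partitions $P(s)$, $s\ge 0$, by $P(s)=P_k$ for $r_k\le s<r_{k+1}$. The diameter bound is the property that for every scale $r\ge 0$, $\mathrm{diam}(C)\le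 r$ for all blocks $C\in P(r)$. *)

theory Defs
  imports "HOL-Analysis.Abstract_Metric_Spaces" "HOL-Library.Multiset"
begin

text \<open>
  A linkage is given by a function \<open>f\<close> of the family of pairwise distances between two blocks.
  The family is a multiset, so that linkages counting repeated distances (such as average linkage)
  are included; an \<open>f\<close> that only depends on the set of distances factors through \<^const>\<open>set_mset\<close>.
\<close>

definition linkage :: "(real multiset \<Rightarrow> real) \<Rightarrow> ('a \<Rightarrow> 'a \<Rightarrow> real) \<Rightarrow> 'a set \<Rightarrow> 'a set \<Rightarrow> real"
  where "linkage f d A B = f (image_mset (\<lambda>(x, y). d x y) (mset_set (A \<times> B)))"

text \<open>
  The nonempty finite multisets of positive reals are exactly the distance families between
  disjoint nonempty subsets of finite metric spaces, so nothing is required of \<open>f\<close> elsewhere.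
\<close>

definition linkage_function :: "(real multiset \<Rightarrow> real) \<Rightarrow> bool"
  where "linkage_function f \<longleftrightarrow> (\<forall>D. D \<noteq> {#} \<and> (\<forall>t\<in>#D. 0 < t) \<longrightarrow> 0 \<le> f D)"

definition complete_linkage :: "real multiset \<Rightarrow> real"
  where "complete_linkage D = Max_mset D"

definition diam :: "('a \<Rightarrow> 'a \<Rightarrow> real) \<Rightarrow> 'a set \<Rightarrow> real"
  where "diam d C = Max {d x y | x y. x \<in> C \<and> y \<in> C}"

text \<open>
  A run of hierarchical clustering: \<open>P 0, \<dots>, P N\<close> are the partitions, \<open>A k\<close> and \<open>B k\<close> the blocks
  merged in passing from \<open>P k\<close> to \<open>P (Suc k)\<close>, and \<open>r k\<close> the merge scales. Ties may be broken
  arbitrarily, so a space can have several runs. Only the values at indices up to \<open>N\<close> matter.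
\<close>

locale hierarchical_clustering = Metric_space X d
  for X :: "'a set" and d :: "'a \<Rightarrow> 'a \<Rightarrow> real" +
  fixes f :: "real multiset \<Rightarrow> real"
    and N :: nat
    and P :: "nat \<Rightarrow> 'a set set"
    and A B :: "nat \<Rightarrow> 'a set"
    and r :: "nat \<Rightarrow> real"
  assumes finite_space: "finite X"
    and initial: "P 0 = {{x} | x. x \<in> X}"
    and final: "P N = {X}"
    and merged_blocks: "k < N \<Longrightarrow> A k \<in> P k \<and> B k \<in> P k \<and> A k \<noteq> B k"
    and minimal: "\<lbrakk>k < N; C \<in> P k; D \<in> P k; C \<noteq> D\<rbrakk>
                    \<Longrightarrow> linkage f d (A k) (B k) \<le> linkage f d C D"
    and merge: "k < N \<Longrightarrow> P (Suc k) = insert (A k \<union> B k) (P k - {A k, B k})"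
    and scale_0: "r 0 = 0"
    and scale_Suc: "k < N \<Longrightarrow> r (Suc k) = linkage f d (A k) (B k)"

text \<open>
  \<open>Q\<close> is the partition \<open>P(s)\<close>, i.e. \<open>Q = P k\<close> with \<open>r k \<le> s < r (k + 1)\<close>, where
  \<open>r (N + 1)\<close> is read as infinity. This is a relation because \<open>r\<close> need not be monotone for a
  general linkage, in which case more than one \<open>k\<close> may qualify.
\<close>

definition partition_at ::
    "nat \<Rightarrow> (nat \<Rightarrow> 'a set set) \<Rightarrow> (nat \<Rightarrow> real) \<Rightarrow> real \<Rightarrow> 'a set set \<Rightarrow> bool"
  where "partition_at N P r s Q \<longleftrightarrow>
    (\<exists>k\<le>N. Q = P k \<and> r k \<le> s \<and> (k < N \<longrightarrow> s < r (Suc k)))"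

definition diameter_bound ::
    "('a \<Rightarrow> 'a \<Rightarrow> real) \<Rightarrow> nat \<Rightarrow> (nat \<Rightarrow> 'a set set) \<Rightarrow> (nat \<Rightarrow> real) \<Rightarrow> bool"
  where "diameter_bound d N P r \<longleftrightarrow>
    (\<forall>s\<ge>0. \<forall>Q. partition_at N P r s Q \<longrightarrow> (\<forall>C\<in>Q. diam d C \<le> s))"

text \<open>
  Every finite metric space is isometric to one whose points are natural numbers, so quantifying
  over finite \<open>X :: nat set\<close> and all metrics on them amounts to all finite metric spaces.
\<close>

definition respects_diameter_bound :: "(real multiset \<Rightarrow> real) \<Rightarrow> bool"
  where "respects_diameter_bound f \<longleftrightarrow>
    (\<forall>(X :: nat set) d N P A B r.
       hierarchical_clustering X d f N P A B r \<longrightarrow> diameter_bound d N P r)"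

end

theory Submission
  imports Defs
begin

text \<open>
  A merge scale need not be the scale at which the merged block first appears in \<open>P(s)\<close>, as the
  scales may decrease later on. But if \<open>j\<close> is the last index with \<open>r j \<le> s\<close> for \<open>s = r (k + 1)\<close>,
  then \<open>P j\<close> is the partition at scale \<open>s\<close>, and as \<open>j > k\<close> it has a block containing
  \<open>A k \<union> B k\<close>; the diameter bound for that block gives the claim. For complete linkage the scales
  do increase, because merging blocks never brings them closer to a third one. Hence the scale of a
  merge dominates all distances inside the two merged blocks.
\<close>

section \<open>Linkage values and diameters under isometries and as bounds on distances\<close>

lemma linkage_image:
  assumes "inj_on h A" and "inj_on h B"
    and "\<And>x y. x \<in> A \<Longrightarrow> y \<in> B \<Longrightarrow> d' (h x) (h y) = d x y"
  shows "linkage f d' (h ` A) (h ` B) = linkage f d A B"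
proof -
  have inj: "inj_on (map_prod h h) (A \<times> B)"
    using assms(1,2) by (rule map_prod_inj_on)
  have "mset_set (h ` A \<times> h ` B) = image_mset (map_prod h h) (mset_set (A \<times> B))"
    using image_mset_mset_set[OF inj] by (simp add: map_prod_surj_on)
  moreover have "image_mset ((\<lambda>(x, y). d' x y) \<circ> map_prod h h) (mset_set (A \<times> B))
      = image_mset (\<lambda>(x, y). d x y) (mset_set (A \<times> B))"
  proof (rule image_mset_cong)
    fix p assume "p \<in># mset_set (A \<times> B)"
    \<comment> \<open>\<open>mset_set\<close> of an infinite set is empty, so membership of
      \<open>p\<close> already forces \<open>A \<times> B\<close> to be finite.\<close>
    then have "p \<in> A \<times> B"
      by (metis elem_mset_set empty_iff mset_set.infinite set_mset_empty)
    then show "((\<lambda>(x, y). d' x y) \<circ> map_prod h h) p = (\<lambda>(x, y). d x y) p"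
      using assms(3) by auto
  qed
  ultimately show ?thesis
    by (simp add: linkage_def multiset.map_comp)
qed

lemma diam_image:
  assumes "\<And>x y. x \<in> C \<Longrightarrow> y \<in> C \<Longrightarrow> d' (h x) (h y) = d x y"
  shows "diam d' (h ` C) = diam d C"
proof -
  have "{d' x y | x y. x \<in> h ` C \<and> y \<in> h ` C} = {d x y | x y. x \<in> C \<and> y \<in> C}"
    using assms by (auto; metis imageI)
  then show ?thesis
    by (simp add: diam_def)
qed

text \<open>Turns \<open>Max\<close> into pointwise bounds. Taking \<open>s\<close> to be the
  maximum itself shows that it bounds every distance; \<open>complete_linkage_le_iff\<close> is used
  in the same way.\<close>

lemma diam_le_iff:
  assumes "finite C" and "C \<noteq> {}"
  shows "diam d C \<le> s \<longleftrightarrow> (\<forall>x\<in>C. \<forall>y\<in>C. d x y \<le> s)"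
proof -
  have eq: "{d x y | x y. x \<in> C \<and> y \<in> C} = (\<lambda>(x, y). d x y) ` (C \<times> C)"
    by auto
  show ?thesis
    unfolding diam_def eq using assms by (subst Max_le_iff) auto
qed

lemma complete_linkage_le_iff:
  assumes "finite C" "finite D" "C \<noteq> {}" "D \<noteq> {}"
  shows "linkage complete_linkage d C D \<le> s \<longleftrightarrow> (\<forall>x\<in>C. \<forall>y\<in>D. d x y \<le> s)"
  unfolding linkage_def complete_linkage_def using assms
  by (subst Max_le_iff) auto

section \<open>Runs of an arbitrary linkage\<close>

context hierarchical_clustering
begin

text \<open>The locale only prescribes the first and last family and the merge rule. That every
  stage is a partition follows by induction, since the union of two blocks stays disjoint from the
  others.\<close>

lemma partition_on_P: "k \<le> N \<Longrightarrow> partition_on X (P k)"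
proof (induction k)
  case 0
  show ?case
    unfolding initial by (rule partition_onI) (auto simp: disjnt_def)
next
  case (Suc k)
  then have part: "partition_on X (P k)" and k: "k < N"
    by simp_all
  note AB = merged_blocks[OF k]
  have disj: "E \<inter> F = {}" if "E \<in> P k" "F \<in> P k" "E \<noteq> F" for E F
    using partition_onD2[OF part] that by (auto simp: disjoint_def)
  show ?case
    unfolding merge[OF k]
  proof (rule partition_onI)
    show "\<Union> (insert (A k \<union> B k) (P k - {A k, B k})) = X"
      using partition_onD1[OF part] AB by blast
    fix E F
    assume "E \<in> insert (A k \<union> B k) (P k - {A k, B k})"
      and "F \<in> insert (A k \<union> B k) (P k - {A k, B k})" and "E \<noteq> F"
    then show "disjnt E F"
      using disj AB unfolding disjnt_def by (auto simp: Int_Un_distrib Int_Un_distrib2)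
  next
    show "{} \<notin> insert (A k \<union> B k) (P k - {A k, B k})"
      using partition_onD3[OF part] AB by auto
  qed
qed

lemma block:
  assumes "k \<le> N" and "C \<in> P k"
  shows "C \<subseteq> X" and "finite C" and "C \<noteq> {}"
proof -
  show "C \<subseteq> X"
    using partition_onD1[OF partition_on_P[OF assms(1)]] assms(2) by blast
  then show "finite C"
    using finite_space finite_subset by blast
  show "C \<noteq> {}"
    using partition_onD3[OF partition_on_P[OF assms(1)]] assms(2) by blast
qed

lemma coarser:
  assumes "i \<le> j" "j \<le> N" "C \<in> P i"
  shows "\<exists>D\<in>P j. C \<subseteq> D"
  using assms
proof (induction j rule: dec_induct)
  case (step j)
  then obtain D where D: "D \<in> P j" "C \<subseteq> D"
    by auto
  then show ?case
    using merge[of j] step.prems by (cases "D = A j \<or> D = B j") auto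
qed auto

text \<open>\<open>diameter_bound\<close> speaks only of scales \<open>s \<ge> 0\<close>, so merge
  scales must be shown admissible. Distinct blocks are disjoint, hence all distances between them
  are positive, which is where \<open>linkage_function\<close> constrains \<open>f\<close>.\<close>

lemma linkage_nonneg:
  assumes "linkage_function f" "k < N"
  shows "0 \<le> linkage f d (A k) (B k)"
proof -
  have k: "k \<le> N"
    using assms(2) by simp
  note AB = merged_blocks[OF assms(2)]
  have "A k \<inter> B k = {}"
    using partition_onD2[OF partition_on_P[OF k]] AB by (auto simp: disjoint_def)
  moreover have "finite (A k \<times> B k)" "A k \<times> B k \<noteq> {}" "A k \<subseteq> X" "B k \<subseteq> X"
    using AB block[OF k] by auto
  moreover from calculation have "0 < d x y" if "x \<in> A k" "y \<in> B k" for x y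
    using mdist_pos_less[of x y] that by blast
  ultimately have "\<forall>t\<in>#image_mset (\<lambda>(x, y). d x y) (mset_set (A k \<times> B k)). 0 < t"
    and "image_mset (\<lambda>(x, y). d x y) (mset_set (A k \<times> B k)) \<noteq> {#}"
    by (auto simp: mset_set_empty_iff)
  then show ?thesis
    using assms(1) unfolding linkage_function_def linkage_def by blast
qed

lemma diam_merge_le:
  assumes "linkage_function f" "diameter_bound d N P r" "k < N"
  shows "diam d (A k \<union> B k) \<le> linkage f d (A k) (B k)"
proof -
  let ?s = "linkage f d (A k) (B k)"
  let ?J = "{j. k < j \<and> j \<le> N \<and> r j \<le> ?s}"
  define j where "j = Max ?J"
  have "finite ?J" "Suc k \<in> ?J"
    using assms(3) scale_Suc by auto
  then have j: "j \<in> ?J" and max: "\<And>i. i \<in> ?J \<Longrightarrow> i \<le> j"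
    unfolding j_def using Max_in by blast (use \<open>finite ?J\<close> in simp)
  \<comment> \<open>Otherwise \<open>Suc j\<close> would be a larger element of \<open>?J\<close>.
    For \<open>j = N\<close> the next scale is read as infinity.\<close>
  have "?s < r (Suc j)" if "j < N"
    using max[of "Suc j"] j that by fastforce
  then have at: "partition_at N P r ?s (P j)"
    using j unfolding partition_at_def by blast
  have new: "A k \<union> B k \<in> P (Suc k)"
    using merge assms(3) by simp
  obtain C where C: "C \<in> P j" "A k \<union> B k \<subseteq> C"
    using coarser[OF _ _ new, of j] j by auto
  have "diam d C \<le> ?s"
    using assms(2) at C(1) linkage_nonneg[OF assms(1,3)] unfolding diameter_bound_def by blast
  then have "\<forall>x\<in>C. \<forall>y\<in>C. d x y \<le> ?s"
    using diam_le_iff block[of j C] C(1) j by blast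
  moreover have "finite (A k \<union> B k)" "A k \<union> B k \<noteq> {}"
    using block[OF _ new] assms(3) by auto
  ultimately show ?thesis
    using C(2) diam_le_iff[of "A k \<union> B k"] by blast
qed

text \<open>\<open>respects_diameter_bound\<close> quantifies over spaces of natural numbers, so a
  run on \<open>X\<close> has to be carried there. An isometry preserves all linkage values, hence
  the same merges are minimal and \<open>r\<close> is unchanged.\<close>

lemma transport:
  assumes h: "inj_on h X"
    and iso: "\<And>x y. x \<in> X \<Longrightarrow> y \<in> X \<Longrightarrow> d' (h x) (h y) = d x y"
    and metric: "Metric_space (h ` X) d'"
  shows "hierarchical_clustering (h ` X) d' f N (\<lambda>k. (`) h ` P k) (\<lambda>k. h ` A k) (\<lambda>k. h ` B k) r"
proof -
  interpret M: Metric_space "h ` X" d'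
    by (rule metric)
  have sub: "P k \<subseteq> Pow X" if "k \<le> N" for k
    using block(1) that by blast
  have inj: "inj_on ((`) h) (Pow X)"
    using h by (rule inj_on_image_Pow)
  have link: "linkage f d' (h ` C) (h ` D) = linkage f d C D" if "C \<subseteq> X" "D \<subseteq> X" for C D
    using that h iso by (intro linkage_image) (auto intro: inj_on_subset)
  have AB: "A k \<subseteq> X" "B k \<subseteq> X" if "k < N" for k
    using merged_blocks[OF that] block(1)[of k] that by auto
  show ?thesis
  proof unfold_locales
    show "finite (h ` X)"
      using finite_space by simp
    show "(`) h ` P 0 = {{x} | x. x \<in> h ` X}"
      unfolding initial by auto
    show "(`) h ` P N = {h ` X}"
      unfolding final by simp
    show "r 0 = 0"
      by (rule scale_0)
    fix k assume k: "k < N"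
    show "h ` A k \<in> (`) h ` P k \<and> h ` B k \<in> (`) h ` P k \<and> h ` A k \<noteq> h ` B k"
      using merged_blocks[OF k] AB[OF k] inj_on_image_eq_iff[OF h] by blast
    show "(`) h ` P (Suc k) = insert (h ` A k \<union> h ` B k) ((`) h ` P k - {h ` A k, h ` B k})"
    proof -
      have "(`) h ` (P k - {A k, B k}) = (`) h ` P k - (`) h ` {A k, B k}"
        using sub[of k] AB[OF k] k by (intro inj_on_image_set_diff[OF inj]) auto
      then show ?thesis
        unfolding merge[OF k] by (simp add: image_Un)
    qed
    show "r (Suc k) = linkage f d' (h ` A k) (h ` B k)"
      using scale_Suc[OF k] link AB[OF k] by simp
    fix C' D' assume "C' \<in> (`) h ` P k" "D' \<in> (`) h ` P k" "C' \<noteq> D'"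
    then obtain C D where CD: "C \<in> P k" "D \<in> P k" "C' = h ` C" "D' = h ` D" "C \<noteq> D"
      by blast
    moreover have "C \<subseteq> X" "D \<subseteq> X"
      using sub[of k] CD k by auto
    ultimately show "linkage f d' (h ` A k) (h ` B k) \<le> linkage f d' C' D'"
      using minimal[OF k, of C D] link AB[OF k] by simp
  qed
qed

lemma respects_imp_diameter_bound:
  assumes "respects_diameter_bound f"
  shows "diameter_bound d N P r"
proof -
  obtain h :: "'a \<Rightarrow> nat" where h: "inj_on h X"
    using finite_imp_inj_to_nat_seg[OF finite_space] by blast
  define d' where "d' = (\<lambda>x y. d (inv_into X h x) (inv_into X h y))"
  have iso: "d' (h x) (h y) = d x y" if "x \<in> X" "y \<in> X" for x y
    using that h by (simp add: d'_def)
  have "Metric_space (h ` X) d'"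
  proof
    show "0 \<le> d' x y" "d' x y = d' y x" for x y
      by (simp_all add: d'_def commute)
    show "d' x y = 0 \<longleftrightarrow> x = y" if "x \<in> h ` X" "y \<in> h ` X" for x y
      using that iso by (auto simp: inj_on_eq_iff[OF h])
    show "d' x z \<le> d' x y + d' y z" if "x \<in> h ` X" "y \<in> h ` X" "z \<in> h ` X" for x y z
      using that iso triangle by auto
  qed
  from transport[OF h iso this] have bound: "diameter_bound d' N (\<lambda>k. (`) h ` P k) r"
    using assms unfolding respects_diameter_bound_def by blast
  show ?thesis
    unfolding diameter_bound_def
  proof (intro allI impI ballI)
    fix s Q C
    assume s: "0 \<le> s" and Q: "partition_at N P r s Q" and C: "C \<in> Q"
    have "partition_at N (\<lambda>k. (`) h ` P k) r s ((`) h ` Q)"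
      using Q unfolding partition_at_def by blast
    then have "diam d' (h ` C) \<le> s"
      using bound s C unfolding diameter_bound_def by blast
    moreover have "C \<subseteq> X"
      using Q C block(1) unfolding partition_at_def by blast
    ultimately show "diam d C \<le> s"
      using diam_image[of C d' h d] iso by (simp add: subset_iff)
  qed
qed

end

section \<open>Complete linkage\<close>

lemma linkage_commute:
  assumes "\<And>x y. d x y = d y x"
  shows "linkage f d C D = linkage f d D C"
proof -
  have "mset_set (C \<times> D) = image_mset prod.swap (mset_set (D \<times> C))"
    by (subst image_mset_mset_set) (auto simp: product_swap)
  moreover have "(\<lambda>(x, y). d x y) \<circ> prod.swap = (\<lambda>(x, y). d x y)"
    using assms by auto
  ultimately show ?thesis
    by (simp add: linkage_def multiset.map_comp)
qed

locale complete_linkage_clustering = hierarchical_clustering X d complete_linkage N P A B r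
  for X :: "'a set" and d N P A B r
begin

abbreviation "L \<equiv> linkage complete_linkage d"

text \<open>A maximum over more pairs can only grow. This is what keeps the merge scales from
  decreasing.\<close>

lemma L_mono:
  assumes "finite C'" "finite D" "C \<noteq> {}" "D \<noteq> {}" "C \<subseteq> C'"
  shows "L C D \<le> L C' D"
proof -
  have "finite C" "C' \<noteq> {}"
    using assms finite_subset by blast+
  then show ?thesis
    using complete_linkage_le_iff[of C' D d "L C' D"] complete_linkage_le_iff[of C D d "L C' D"] assms
    by blast
qed

text \<open>A pair inside one of the two blocks is covered by \<open>old\<close>; a pair across them
  is bounded by the maximum that defines the linkage.\<close>

lemma dist_in_merge_le:
  assumes k: "k < N"
    and old: "\<And>C x y. \<lbrakk>C \<in> P k; x \<in> C; y \<in> C\<rbrakk> \<Longrightarrow> d x y \<le> L (A k) (B k)"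
    and xy: "x \<in> A k \<union> B k" "y \<in> A k \<union> B k"
  shows "d x y \<le> L (A k) (B k)"
proof -
  note AB = merged_blocks[OF k]
  have across: "d u v \<le> L (A k) (B k)" if "u \<in> A k" "v \<in> B k" for u v
    using complete_linkage_le_iff[of "A k" "B k" d "L (A k) (B k)"] block[of k] AB k that by auto
  then have "d v u \<le> L (A k) (B k)" if "u \<in> A k" "v \<in> B k" for u v
    using that commute[of v u] by simp
  with across show ?thesis
    using xy old[of "A k"] old[of "B k"] AB by blast
qed

text \<open>The two halves are proved together: the second, applied to the next merged pair, gives
  \<open>r k \<le> r (Suc k)\<close>, and this lets the first half pass to the next stage. The
  second half itself is renewed by \<open>minimal\<close> and \<open>L_mono\<close>.\<close>

lemma scale_invariant:
  assumes "k \<le> N"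
  shows "(\<forall>C\<in>P k. \<forall>x\<in>C. \<forall>y\<in>C. d x y \<le> r k) \<and> (\<forall>C\<in>P k. \<forall>D\<in>P k. C \<noteq> D \<longrightarrow> r k \<le> L C D)"
  using assms
proof (induction k)
  case 0
  have "0 \<le> L {x} {y}" for x y
    by (simp add: linkage_def complete_linkage_def)
  then show ?case
    unfolding initial scale_0 by auto
next
  case (Suc k)
  then have k: "k < N" and kN: "k \<le> N"
    and small: "\<And>C x y. \<lbrakk>C \<in> P k; x \<in> C; y \<in> C\<rbrakk> \<Longrightarrow> d x y \<le> r k"
    and far: "\<And>C D. \<lbrakk>C \<in> P k; D \<in> P k; C \<noteq> D\<rbrakk> \<Longrightarrow> r k \<le> L C D"
    by auto
  note AB = merged_blocks[OF k]
  have rS: "r (Suc k) = L (A k) (B k)"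
    using scale_Suc[OF k] .
  have "r k \<le> L (A k) (B k)"
    using far AB by blast
  then have old: "d x y \<le> L (A k) (B k)" if "C \<in> P k" "x \<in> C" "y \<in> C" for C x y
    using small that by fastforce
  have "d x y \<le> r (Suc k)" if "C \<in> P (Suc k)" "x \<in> C" "y \<in> C" for C x y
  proof (cases "C \<in> P k")
    case True
    then show ?thesis
      using old that unfolding rS by blast
  next
    case False
    then have "C = A k \<union> B k"
      using that unfolding merge[OF k] by blast
    then have "x \<in> A k \<union> B k" "y \<in> A k \<union> B k"
      using that by simp_all
    then show ?thesis
      unfolding rS by (rule dist_in_merge_le[OF k, rotated]) (rule old)
  qed
  moreover have "r (Suc k) \<le> L C D" if CD: "C \<in> P (Suc k)" "D \<in> P (Suc k)" "C \<noteq> D" for C D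
  proof -
    \<comment> \<open>Only the pair \<open>A k\<close>, \<open>D\<close> is compared by minimality
      before \<open>A k\<close> is enlarged, so \<open>D\<close> merely has to differ from
      \<open>A k\<close>.\<close>
    have new: "L (A k) (B k) \<le> L (A k \<union> B k) D" if "D \<in> P k" "D \<noteq> A k" for D
    proof -
      have "L (A k) (B k) \<le> L (A k) D"
        using minimal[OF k] AB that by blast
      also have "\<dots> \<le> L (A k \<union> B k) D"
        using block[OF kN] AB that by (intro L_mono) auto
      finally show ?thesis .
    qed
    consider "C \<in> P k" "D \<in> P k" | "C = A k \<union> B k" "D \<in> P k" "D \<noteq> A k"
      | "D = A k \<union> B k" "C \<in> P k" "C \<noteq> A k"
      using CD unfolding merge[OF k] by blast
    then show ?thesis
    proof cases
      case 1
      then show ?thesis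
        using minimal[OF k] CD unfolding rS by blast
    next
      case 2
      then show ?thesis
        using new unfolding rS by blast
    next
      \<comment> \<open>The new block is now the second argument; symmetry of the linkage reduces
        this to the previous case.\<close>
      case 3
      then show ?thesis
        using new linkage_commute[OF commute, where C = C and D = D] unfolding rS by simp
    qed
  qed
  ultimately show ?case
    by blast
qed

lemma merge_eq_diam:
  assumes k: "k < N"
  shows "L (A k) (B k) = diam d (A k \<union> B k)"
proof (rule antisym)
  note AB = merged_blocks[OF k]
  have fin: "finite (A k)" "finite (B k)" "A k \<noteq> {}" "B k \<noteq> {}"
    using block[of k] AB k by auto
  show "L (A k) (B k) \<le> diam d (A k \<union> B k)"
    using diam_le_iff[of "A k \<union> B k" d "diam d (A k \<union> B k)"] fin
    by (subst complete_linkage_le_iff) auto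
  \<comment> \<open>The invariant is taken one stage later, where \<open>A k \<union> B k\<close> is
    itself a block and \<open>r (Suc k)\<close> is the scale of its merge.\<close>
  have "\<forall>C\<in>P (Suc k). \<forall>x\<in>C. \<forall>y\<in>C. d x y \<le> r (Suc k)"
    using scale_invariant k by simp
  then show "diam d (A k \<union> B k) \<le> L (A k) (B k)"
    using fin unfolding merge[OF k] scale_Suc[OF k] by (subst diam_le_iff) auto
qed

end

theorem proposition5p3:
  fixes X :: "'a set" and d :: "'a \<Rightarrow> 'a \<Rightarrow> real"
  assumes "Metric_space X d" and "finite X"
  shows "(\<forall>f. linkage_function f \<and> respects_diameter_bound f \<longrightarrow>
            (\<forall>N P A B r. hierarchical_clustering X d f N P A B r \<longrightarrow>
               (\<forall>k<N. linkage f d (A k) (B k) \<ge> diam d (A k \<union> B k)))) \<and>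
         (\<forall>N P A B r. hierarchical_clustering X d complete_linkage N P A B r \<longrightarrow>
            (\<forall>k<N. linkage complete_linkage d (A k) (B k) = diam d (A k \<union> B k)))"
proof (intro conjI allI impI)
  fix f N P A B r k
  assume f: "linkage_function f \<and> respects_diameter_bound f"
    and "hierarchical_clustering X d f N P A B r" and k: "k < N"
  then interpret hierarchical_clustering X d f N P A B r
    by simp
  show "diam d (A k \<union> B k) \<le> linkage f d (A k) (B k)"
    using f k diam_merge_le respects_imp_diameter_bound by blast
next
  fix N P A B r k
  assume "hierarchical_clustering X d complete_linkage N P A B r" and k: "k < N"
  then interpret complete_linkage_clustering X d N P A B r
    by (simp add: complete_linkage_clustering_def)
  show "linkage complete_linkage d (A k) (B k) = diam d (A k \<union> B k)"
    using k by (rule merge_eq_diam)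
qed

end
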